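(* Let $P$ be a normal logic program with total well-founded model $I \cup \{\neg A : A \in B_P\setminus I\}$, where $I \subseteq B_P$. For $A \in B_P$ let $l(A)$ be the minimal ordinal $\alpha$ such that $\Phi_{\mathrm{fix}(P)}{\uparrow}(\alpha+1)(A) = I(A)$, and for $J,K \in I_P$ let $\varrho(J,K) = \max\{d_l(J,I), d_l(I,K)\}$. Then $(I_P,\varrho)$ is a spherically complete dislocated generalized ultrametric space, and $\mathrm{GL}_P$ is strictly contracting on $(I_P,\varrho)$.
   Context: A normal logic program $P$ is a finite set of (universally quantified) clauses $A \leftarrow L_1,\ldots,L_n$ with $n \ge 0$, where $A$ (the head) is an atom and the $L_i$ (the body literals) are atoms or negated atoms of a first-order language $\mathcal{L}$ (function symbols allowed). $B_P$ is the set of all ground atoms over $\mathcal{L}$ and $\mathrm{ground}(P)$ is the set of all ground instances over $\mathcal{L}$ of clauses of $P$. $I_P$ is the power set of $B_P$ (the set of two-valued interpretations), identified with the set of all functions $B_P \to \{\mathbf{t},\mathbf{f}\}$, so $I(A)=\mathbf{t}$ iff $A \in I$. A program without negation is called definite. For a (possibly infinite) ground definite program $R$, $T_R(I)$ is the set of all $A \in B_P$ for which there is a clause $A \leftarrow A_1,\ldots,A_n$ in $R$ with $A_1,\ldots,A_n \in I$; put $T_R{\uparrow}0=\emptyset$, $T_R{\uparrow}(n+1)=T_R(T_R{\uparrow}n)$, and $\mathrm{fix}(T_R)=\bigcup_{n\in\mathbb{N}} T_R{\uparrow}n$, which is the least fixed point of $T_R$. For $I \in I_P$, the Gelfond-Lifschitz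 transformation $P/I$ is the definite program consisting of exactly those clauses $A \leftarrow A_1,\ldots,A_n$ for which there is a clause $A \leftarrow A_1,\ldots,A_n,\neg B_1,\ldots,\neg B_m$ in $\mathrm{ground}(P)$ with $B_1,\ldots,B_m \notin I$. The Gelfond-Lifschitz operator is $\mathrm{GL}_P : I_P \to I_P$, $\mathrm{GL}_P(I) = \mathrm{fix}(T_{P/I})$. Fixpoint completion: a quasi-interpretation is a set of clauses $A \leftarrow \neg B_1,\ldots,\neg B_m$ ($m\ge 0$) with $A, B_i$ ground atoms. For a quasi-interpretation $S$, $T'_P(S)$ is the set of all clauses $A \leftarrow \mathrm{body}_1,\ldots,\mathrm{body}_n,\neg B_1,\ldots,\neg B_m$ for which there are a clause $A \leftarrow A_1,\ldots,A_n,\neg B_1,\ldots,\neg B_m$ in $\mathrm{ground}(P)$ and clauses $A_i \leftarrow \mathrm{body}_i$ in $S$ for $i=1,\ldots,n$ ($n=0$ or $m=0$ allowed). Put $T'_P{\uparrow}0=\emptyset$, $T'_P{\uparrow}(k+1)=T'_P(T'_P{\uparrow}k)$, and $\mathrm{fix}(P)=\bigcup_{k\in\mathbb{N}}T'_P{\uparrow}k$. A three-valued interpretation is a set $J$ of ground literals containing no complementary pair; equivalently a map from $B_P$ to $\{\mathbf{f},\mathbf{u},\mathbf{t}\}$ with $J(A)=\mathbf{t}$ if $A\in J$, $J(A)=\mathbf{f}$ if $\neg A\in J$, and $J(A)=\mathbf{u}$ otherwise. For a (possibly infinite) set $R$ of ground clauses with atoms in $B_P$, the Fitting operator is $\Phi_R(J)=t_R(J)\cup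 f_R(J)$, where $t_R(J)$ is the set of all $A \in B_P$ for which there is a clause $A\leftarrow L_1,\ldots,L_n$ in $R$ with $L_1,\ldots,L_n\in J$, and $f_R(J)$ is the set of all $\neg A$, $A \in B_P$, such that every clause $A\leftarrow L_1,\ldots,L_n$ in $R$ has some $L_i$ whose complement is in $J$. $\Phi_R$ is monotonic; $\Phi_R{\uparrow}0=\emptyset$, $\Phi_R{\uparrow}(\alpha+1)=\Phi_R(\Phi_R{\uparrow}\alpha)$, and $\Phi_R{\uparrow}\alpha=\bigcup_{\beta<\alpha}\Phi_R{\uparrow}\beta$ for limit ordinals $\alpha$. The well-founded model of $P$ is the standard one (Van Gelder, Ross, Schlipf): a set $U \subseteq B_P$ is unfounded with respect to $J$ if for every $A \in U$ and every clause $A \leftarrow L_1,\ldots,L_n$ in $\mathrm{ground}(P)$ there is an $i$ such that either the complement of $L_i$ belongs to $J$, or $L_i$ is an atom in $U$; let $U_P(J)$ be the greatest unfounded set with respect to $J$, and let $W_P(J)$ be the union of $\{\neg A : A \in U_P(J)\}$ and the set of all $A \in B_P$ for which some clause $A \leftarrow L_1,\ldots,L_n$ in $\mathrm{ground}(P)$ has $L_1,\ldots,L_n \in J$. The well-founded model is the least fixed point of the monotonic operator $W_P$. It is known that the well-founded model of $P$ coincides with the least fixed point of $\Phi_{\mathrm{fix}(P)}$ (the Fitting model of $\mathrm{fix}(P)$), so $l$ in the claim is well-defined. For a level mapping $l : B_P \to \alpha$ ($\alpha$ an ordinal), $\Gamma_l$ is the set of symbols $2^{-\beta}$ for ordinals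 $\beta\le\alpha$, ordered by $2^{-\beta}<2^{-\gamma}$ iff $\gamma<\beta$; its least element $2^{-\alpha}$ is written $0$. For $J\ne K$ in $I_P$, $d_l(J,K)=2^{-\beta}$ with $\beta$ the least ordinal such that $J$ and $K$ disagree on some atom of level $\beta$; $d_l(J,J)=0$. A dislocated generalized ultrametric $\varrho : X\times X\to\Gamma$ ($\Gamma$ an ordered set with least element $0$) satisfies: $\varrho(x,y)=0$ implies $x=y$; $\varrho(x,y)=\varrho(y,x)$; and if $\varrho(x,y)\le\gamma$ and $\varrho(y,z)\le\gamma$ then $\varrho(x,z)\le\gamma$ (but $\varrho(x,x)=0$ is not required). It is spherically complete if every nonempty chain (under $\subseteq$) of nonempty balls $\{y:\varrho(x,y)\le\gamma\}$, $x\in X$, $\gamma\in\Gamma$, has nonempty intersection. A map $f$ is strictly contracting with respect to $\varrho$ if $\varrho(f(x),f(y))<\varrho(x,y)$ for all $x\neq y$. *)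

theory Defs
  imports Main "HOL-Library.Dual_Ordered_Lattice"
begin

section \<open>First-order syntax\<close>

datatype (fterm_funs: 'f, fterm_vars: 'v) fterm =
  Var 'v | Fun 'f "('f, 'v) fterm list"

datatype ('p, 'f, 'v) atom = Atom 'p "('f, 'v) fterm list"

datatype 'a literal = Pos 'a | Neg 'a

datatype (atoms: 'a) clause = Clause (head: 'a) (body: "'a literal list")
  for map: map_clause

text \<open>A symbol is a name together with its arity.\<close>

record ('f, 'p) language =
  fun_symbols :: "('f \<times> nat) set"
  pred_symbols :: "('p \<times> nat) set"

fun wf_fterm :: "('f, 'p) language \<Rightarrow> ('f, 'v) fterm \<Rightarrow> bool" where
  "wf_fterm L (Var x) \<longleftrightarrow> True"
| "wf_fterm L (Fun f ts) \<longleftrightarrow> (f, length ts) \<in> fun_symbols L \<and> (\<forall>t \<in> set ts. wf_fterm L t)"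

fun wf_atom :: "('f, 'p) language \<Rightarrow> ('p, 'f, 'v) atom \<Rightarrow> bool" where
  "wf_atom L (Atom p ts) \<longleftrightarrow> (p, length ts) \<in> pred_symbols L \<and> (\<forall>t \<in> set ts. wf_fterm L t)"

fun atom_vars :: "('p, 'f, 'v) atom \<Rightarrow> 'v set" where
  "atom_vars (Atom p ts) = (\<Union>t \<in> set ts. fterm_vars t)"

fun subst_fterm :: "('v \<Rightarrow> ('f, 'v) fterm) \<Rightarrow> ('f, 'v) fterm \<Rightarrow> ('f, 'v) fterm" where
  "subst_fterm \<sigma> (Var x) = \<sigma> x"
| "subst_fterm \<sigma> (Fun f ts) = Fun f (map (subst_fterm \<sigma>) ts)"

fun subst_atom :: "('v \<Rightarrow> ('f, 'v) fterm) \<Rightarrow> ('p, 'f, 'v) atom \<Rightarrow> ('p, 'f, 'v) atom" where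
  "subst_atom \<sigma> (Atom p ts) = Atom p (map (subst_fterm \<sigma>) ts)"

definition normal_program :: "('f, 'p) language \<Rightarrow> ('p, 'f, 'v) atom clause set \<Rightarrow> bool" where
  "normal_program L P \<longleftrightarrow> finite P \<and> (\<forall>C \<in> P. \<forall>A \<in> atoms C. wf_atom L A)"

definition ground_terms :: "('f, 'p) language \<Rightarrow> ('f, 'v) fterm set" where
  "ground_terms L = {t. wf_fterm L t \<and> fterm_vars t = {}}"

definition herbrand_base :: "('f, 'p) language \<Rightarrow> ('p, 'f, 'v) atom set" where
  "herbrand_base L = {A. wf_atom L A \<and> atom_vars A = {}}"

text \<open>The substitution is constrained on the variables of the clause only, so that a
  variable-free clause has a ground instance even if \<open>L\<close> has no ground terms.\<close>

definition grounding ::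
  "('f, 'p) language \<Rightarrow> ('p, 'f, 'v) atom clause set \<Rightarrow> ('p, 'f, 'v) atom clause set" where
  "grounding L P = {map_clause (subst_atom \<sigma>) C | C \<sigma>.
     C \<in> P \<and> (\<forall>A \<in> atoms C. \<forall>x \<in> atom_vars A. \<sigma> x \<in> ground_terms L)}"

definition pos_body :: "'a clause \<Rightarrow> 'a list" where
  "pos_body C = [A. Pos A \<leftarrow> body C]"

definition neg_body :: "'a clause \<Rightarrow> 'a list" where
  "neg_body C = [A. Neg A \<leftarrow> body C]"


section \<open>Operators of a ground program\<close>

text \<open>Throughout, \<open>B\<close> is the Herbrand base and \<open>G\<close>, \<open>R\<close> are sets of ground clauses.\<close>

definition T_op :: "'a set \<Rightarrow> 'a clause set \<Rightarrow> 'a set \<Rightarrow> 'a set" where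
  "T_op B R I = {A \<in> B. \<exists>As. Clause A (map Pos As) \<in> R \<and> set As \<subseteq> I}"

definition fix_T :: "'a set \<Rightarrow> 'a clause set \<Rightarrow> 'a set" where
  "fix_T B R = (\<Union>n. (T_op B R ^^ n) {})"

definition GL_transform :: "'a clause set \<Rightarrow> 'a set \<Rightarrow> 'a clause set" where
  "GL_transform G I =
     {Clause (head C) (map Pos (pos_body C)) | C. C \<in> G \<and> set (neg_body C) \<inter> I = {}}"

definition GL_op :: "'a set \<Rightarrow> 'a clause set \<Rightarrow> 'a set \<Rightarrow> 'a set" where
  "GL_op B G I = fix_T B (GL_transform G I)"

text \<open>Unfolding: each positive body atom of a clause is replaced by the body of some clause
  of \<open>S\<close> with that head.\<close>

definition T_quasi :: "'a clause set \<Rightarrow> 'a clause set \<Rightarrow> 'a clause set" where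
  "T_quasi G S = {Clause (head C) (concat bs @ map Neg (neg_body C)) | C bs.
     C \<in> G \<and> list_all2 (\<lambda>A b. Clause A b \<in> S) (pos_body C) bs}"

definition fixpoint_completion :: "'a clause set \<Rightarrow> 'a clause set" where
  "fixpoint_completion G = (\<Union>k. (T_quasi G ^^ k) {})"

text \<open>Three-valued interpretations are represented by sets of literals.\<close>

fun compl_lit :: "'a literal \<Rightarrow> 'a literal" where
  "compl_lit (Pos A) = Neg A"
| "compl_lit (Neg A) = Pos A"

datatype truth = FF | UU | TT

definition val3 :: "'a literal set \<Rightarrow> 'a \<Rightarrow> truth" where
  "val3 J A = (if Pos A \<in> J then TT else if Neg A \<in> J then FF else UU)"

definition val2 :: "'a set \<Rightarrow> 'a \<Rightarrow> truth" where
  "val2 I A = (if A \<in> I then TT else FF)"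

definition fitting_op :: "'a set \<Rightarrow> 'a clause set \<Rightarrow> 'a literal set \<Rightarrow> 'a literal set" where
  "fitting_op B R J =
     {Pos A | A. A \<in> B \<and> (\<exists>C \<in> R. head C = A \<and> set (body C) \<subseteq> J)} \<union>
     {Neg A | A. A \<in> B \<and> (\<forall>C \<in> R. head C = A \<longrightarrow> (\<exists>l \<in> set (body C). compl_lit l \<in> J))}"

definition unfounded :: "'a set \<Rightarrow> 'a clause set \<Rightarrow> 'a literal set \<Rightarrow> 'a set \<Rightarrow> bool" where
  "unfounded B G J U \<longleftrightarrow> U \<subseteq> B \<and> (\<forall>A \<in> U. \<forall>C \<in> G. head C = A \<longrightarrow>
     (\<exists>l \<in> set (body C). compl_lit l \<in> J \<or> (\<exists>A' \<in> U. l = Pos A')))"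

definition greatest_unfounded :: "'a set \<Rightarrow> 'a clause set \<Rightarrow> 'a literal set \<Rightarrow> 'a set" where
  "greatest_unfounded B G J = (GREATEST U. unfounded B G J U)"

lemma greatest_unfounded_eq_Union: "greatest_unfounded B G J = \<Union> {U. unfounded B G J U}"
  unfolding greatest_unfounded_def
proof (rule Greatest_equality)
  have sub: "unfounded B G J U \<Longrightarrow> U \<subseteq> \<Union> {U. unfounded B G J U}" for U by blast
  show "unfounded B G J (\<Union> {U. unfounded B G J U})"
    unfolding unfounded_def[of B G J "\<Union> _"]
  proof (intro conjI ballI impI)
    show "\<Union> {U. unfounded B G J U} \<subseteq> B" by (auto simp: unfounded_def)
  next
    fix A C assume "A \<in> \<Union> {U. unfounded B G J U}" "C \<in> G" "head C = A"
    then obtain U where U: "unfounded B G J U" and "A \<in> U" by blast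
    with \<open>C \<in> G\<close> \<open>head C = A\<close> obtain l where "l \<in> set (body C)"
      "compl_lit l \<in> J \<or> (\<exists>A' \<in> U. l = Pos A')"
      unfolding unfounded_def by metis
    with sub[OF U] show "\<exists>l \<in> set (body C).
        compl_lit l \<in> J \<or> (\<exists>A' \<in> \<Union> {U. unfounded B G J U}. l = Pos A')" by blast
  qed
qed blast

definition W_op :: "'a set \<Rightarrow> 'a clause set \<Rightarrow> 'a literal set \<Rightarrow> 'a literal set" where
  "W_op B G J = Neg ` greatest_unfounded B G J \<union>
     {Pos A | A. A \<in> B \<and> (\<exists>C \<in> G. head C = A \<and> set (body C) \<subseteq> J)}"

lemma mono_W_op: "mono (W_op B G)"
proof (rule monoI)
  fix J K :: "'a literal set" assume JK: "J \<subseteq> K"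
  have "unfounded B G J U \<Longrightarrow> unfounded B G K U" for U
    using JK unfolding unfounded_def by fast
  with JK show "W_op B G J \<subseteq> W_op B G K"
    unfolding W_op_def greatest_unfounded_eq_Union by blast
qed

definition well_founded_model :: "'a set \<Rightarrow> 'a clause set \<Rightarrow> 'a literal set" where
  "well_founded_model B G = lfp (W_op B G)"


section \<open>Ordinals and transfinite iteration\<close>

text \<open>The ordinals of cardinality at most that of \<open>'a list\<close>, i.e. the maximum of
  \<open>\<aleph>\<^sub>0\<close> and the cardinality of \<open>'a\<close>, realised as the elements of the successor cardinal
  of \<open>'a list\<close>. The two lemmas at the end of this section show that these suffice
  to index the iteration of any monotone operator on sets of \<open>'a\<close>-literals up to its closure,
  and to bound any family of such ordinals indexed by \<open>'a\<close>.\<close>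

unbundle cardinal_syntax

typedef 'a ordinal = "Field (cardSuc |UNIV :: 'a list set| )"
  using Field_cardSuc_not_empty card_of_Card_order by blast

lemma cardSuc_list_Card_order: "Card_order (cardSuc |UNIV :: 'a list set| )"
  by (simp add: cardSuc_Card_order card_of_Card_order)

lemma cardSuc_list_wo_rel: "wo_rel (cardSuc |UNIV :: 'a list set| )"
  using cardSuc_list_Card_order unfolding wo_rel_def card_order_on_def by blast

instantiation ordinal :: (type) wellorder
begin

definition less_eq_ordinal :: "'a ordinal \<Rightarrow> 'a ordinal \<Rightarrow> bool" where
  "\<alpha> \<le> \<beta> \<longleftrightarrow> (Rep_ordinal \<alpha>, Rep_ordinal \<beta>) \<in> cardSuc |UNIV :: 'a list set|"

definition less_ordinal :: "'a ordinal \<Rightarrow> 'a ordinal \<Rightarrow> bool" where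
  "(\<alpha> :: 'a ordinal) < \<beta> \<longleftrightarrow> \<alpha> \<le> \<beta> \<and> \<alpha> \<noteq> \<beta>"

instance
proof
  let ?r = "cardSuc |UNIV :: 'a list set|"
  note wo = cardSuc_list_wo_rel[where 'a = 'a]
  fix x y z :: "'a ordinal"
  show le_refl: "x \<le> x"
    using wo_rel.REFL[OF wo] Rep_ordinal[of x] unfolding less_eq_ordinal_def refl_on_def by blast
  show anti: "x \<le> y \<Longrightarrow> y \<le> x \<Longrightarrow> x = y" for x y :: "'a ordinal"
    using wo_rel.ANTISYM[OF wo] unfolding less_eq_ordinal_def antisym_def
    by (metis Rep_ordinal_inject)
  show "x < y \<longleftrightarrow> x \<le> y \<and> \<not> y \<le> x"
    using anti le_refl unfolding less_ordinal_def by blast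
  show "x \<le> y \<Longrightarrow> y \<le> z \<Longrightarrow> x \<le> z"
    using wo_rel.TRANS[OF wo] unfolding less_eq_ordinal_def trans_def by blast
  show "x \<le> y \<or> y \<le> x"
    using wo_rel.TOTALS[OF wo] Rep_ordinal unfolding less_eq_ordinal_def by blast
next
  let ?r = "cardSuc |UNIV :: 'a list set|"
  fix Q :: "'a ordinal \<Rightarrow> bool" and x
  assume step: "\<And>x. (\<And>y. y < x \<Longrightarrow> Q y) \<Longrightarrow> Q x"
  have wf: "wf (?r - Id)"
    using wo_rel.WF[OF cardSuc_list_wo_rel] .
  have "{(y, x). y < x} = inv_image (?r - Id) Rep_ordinal"
    by (auto simp: less_ordinal_def less_eq_ordinal_def inv_image_def Rep_ordinal_inject)
  with wf have "wf {(y, x :: 'a ordinal). y < x}" by simp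
  then show "Q x" by (induct x rule: wf_induct_rule) (use step in blast)
qed

end

instantiation ordinal :: (type) zero
begin

definition zero_ordinal :: "'a ordinal" where "(0 :: 'a ordinal) = (LEAST \<alpha>. True)"

instance ..

end

definition osuc :: "'a ordinal \<Rightarrow> 'a ordinal" where
  "osuc \<alpha> = (LEAST \<beta>. \<alpha> < \<beta>)"

lemma ordinal_gt_ex: "\<exists>\<beta>. (\<alpha> :: 'a ordinal) < \<beta>"
proof -
  let ?r = "cardSuc |UNIV :: 'a list set|"
  have "\<not> finite (Field ?r)"
    by (simp add: card_of_cardSuc_finite infinite_UNIV_listI)
  then obtain b where "b \<in> Field ?r" "Rep_ordinal \<alpha> \<noteq> b" "(Rep_ordinal \<alpha>, b) \<in> ?r"
    using infinite_Card_order_limit[OF cardSuc_list_Card_order _ Rep_ordinal] by metis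
  then have "\<alpha> < Abs_ordinal b"
    by (auto simp: less_ordinal_def less_eq_ordinal_def Abs_ordinal_inverse)
  then show ?thesis ..
qed

lemma less_osuc: "\<alpha> < osuc \<alpha>"
  unfolding osuc_def by (rule LeastI_ex[OF ordinal_gt_ex])

lemma less_osuc_iff: "\<beta> < osuc \<alpha> \<longleftrightarrow> \<beta> \<le> \<alpha>"
  by (metis less_osuc leD le_less_trans not_le not_less_Least osuc_def)

lemma osuc_inject [simp]: "osuc \<alpha> = osuc \<beta> \<longleftrightarrow> \<alpha> = \<beta>"
  by (metis less_osuc_iff order_antisym order_refl)

lemma osuc_neq_0 [simp]: "osuc \<alpha> \<noteq> 0"
  by (metis Least_le TrueI less_osuc leD zero_ordinal_def)

function transfinite_iter :: "('b set \<Rightarrow> 'b set) \<Rightarrow> 'a ordinal \<Rightarrow> 'b set" where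
  "transfinite_iter F \<alpha> =
     (if \<alpha> = 0 then {}
      else if \<exists>\<beta>. \<alpha> = osuc \<beta> then F (transfinite_iter F (THE \<beta>. \<alpha> = osuc \<beta>))
      else (\<Union>\<beta> \<in> {..<\<alpha>}. transfinite_iter F \<beta>))"
  by pat_completeness auto
termination
proof (relation "inv_image {(\<beta>, \<alpha>). \<beta> < \<alpha>} snd", goal_cases)
  case 1
  show ?case by (rule wf_inv_image) (rule wf)
qed (auto simp: less_osuc)

declare transfinite_iter.simps [simp del]

lemma transfinite_iter_0: "transfinite_iter F 0 = {}"
  by (simp add: transfinite_iter.simps)

lemma transfinite_iter_osuc: "transfinite_iter F (osuc \<alpha>) = F (transfinite_iter F \<alpha>)"
  by (subst transfinite_iter.simps) simp

lemma transfinite_iter_limit: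
  "\<alpha> \<noteq> 0 \<Longrightarrow> (\<And>\<beta>. \<alpha> \<noteq> osuc \<beta>) \<Longrightarrow>
   transfinite_iter F \<alpha> = (\<Union>\<beta> \<in> {..<\<alpha>}. transfinite_iter F \<beta>)"
  by (subst transfinite_iter.simps) simp

lemma card_ordinal_greater: "|UNIV :: 'a list set| <o |UNIV :: 'a ordinal set|"
proof -
  let ?r = "cardSuc |UNIV :: 'a list set|"
  have "bij_betw Abs_ordinal (Field ?r) (UNIV :: 'a ordinal set)"
    unfolding bij_betw_def
    by (auto simp: inj_on_def Abs_ordinal_inject) (metis Rep_ordinal Rep_ordinal_inverse imageI)
  then have "|Field ?r| =o |UNIV :: 'a ordinal set|"
    using card_of_ordIso by blast
  moreover have "?r =o |Field ?r|"
    using card_of_Field_ordIso[OF cardSuc_list_Card_order] ordIso_symmetric by blast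
  ultimately show ?thesis
    using cardSuc_greater[OF card_of_Card_order] ordIso_transitive ordLess_ordIso_trans by blast
qed

lemma transfinite_iter_mono:
  fixes F :: "'b set \<Rightarrow> 'b set" and \<alpha> \<beta> :: "'a ordinal"
  assumes "mono F"
  shows "\<beta> \<le> \<alpha> \<Longrightarrow> transfinite_iter F \<beta> \<subseteq> transfinite_iter F \<alpha>"
proof -
  have lim: "transfinite_iter F \<beta> \<subseteq> transfinite_iter F \<alpha>"
    if "\<beta> < \<alpha>" "\<alpha> \<noteq> 0" "\<And>\<gamma>. \<alpha> \<noteq> osuc \<gamma>" for \<alpha> \<beta> :: "'a ordinal"
    using that by (auto simp: transfinite_iter_limit)
  have step: "transfinite_iter F \<alpha> \<subseteq> F (transfinite_iter F \<alpha>)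
      \<and> (\<forall>\<beta> \<le> \<alpha>. transfinite_iter F \<beta> \<subseteq> transfinite_iter F \<alpha>)" for \<alpha> :: "'a ordinal"
  proof (induct \<alpha> rule: less_induct)
    case (less \<alpha>)
    consider "\<alpha> = 0" | \<gamma> where "\<alpha> = osuc \<gamma>" | "\<alpha> \<noteq> 0" "\<And>\<gamma>. \<alpha> \<noteq> osuc \<gamma>" by blast
    then show ?case
    proof cases
      case 1
      then have "\<beta> \<le> \<alpha> \<Longrightarrow> \<beta> = 0" for \<beta>
        by (metis Least_le TrueI order_antisym zero_ordinal_def)
      then show ?thesis using 1 transfinite_iter_0[of F] by (metis empty_subsetI)
    next
      case 2
      then have "\<gamma> < \<alpha>" by (simp add: less_osuc)
      note IH = less[OF this]
      from IH 2 have sub: "transfinite_iter F \<alpha> \<subseteq> F (transfinite_iter F \<alpha>)"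
        by (metis assms monoD transfinite_iter_osuc)
      have "transfinite_iter F \<beta> \<subseteq> transfinite_iter F \<alpha>" if "\<beta> \<le> \<alpha>" for \<beta>
        using that IH 2 by (metis dual_order.trans le_less less_osuc_iff transfinite_iter_osuc)
      with sub show ?thesis by blast
    next
      case 3
      have le: "transfinite_iter F \<beta> \<subseteq> transfinite_iter F \<alpha>" if "\<beta> \<le> \<alpha>" for \<beta>
        using lim[of \<beta> \<alpha>] 3 that by (cases "\<beta> = \<alpha>") auto
      have "transfinite_iter F \<beta> \<subseteq> F (transfinite_iter F \<alpha>)" if "\<beta> < \<alpha>" for \<beta>
        using less[OF that] monoD[OF assms le[OF less_imp_le[OF that]]] by blast
      then have "transfinite_iter F \<alpha> \<subseteq> F (transfinite_iter F \<alpha>)"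
        using transfinite_iter_limit[OF 3, of F] by auto
      with le show ?thesis by blast
    qed
  qed
  then show "\<beta> \<le> \<alpha> \<Longrightarrow> transfinite_iter F \<beta> \<subseteq> transfinite_iter F \<alpha>" by blast
qed

lemma transfinite_iter_closure:
  fixes F :: "'a literal set \<Rightarrow> 'a literal set"
  assumes "mono F"
  shows "\<exists>\<alpha> :: 'a ordinal. transfinite_iter F \<alpha> = lfp F"
proof -
  have "\<exists>\<alpha> :: 'a ordinal. transfinite_iter F (osuc \<alpha>) = transfinite_iter F \<alpha>"
  proof (rule ccontr)
    assume "\<not> ?thesis"
    then have "\<exists>l. l \<in> transfinite_iter F (osuc \<alpha>) - transfinite_iter F \<alpha>" for \<alpha> :: "'a ordinal"
      using transfinite_iter_mono[OF assms, of \<alpha> "osuc \<alpha>"] less_osuc[of \<alpha>] by force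
    then obtain g :: "'a ordinal \<Rightarrow> 'a literal"
      where g: "g \<alpha> \<in> transfinite_iter F (osuc \<alpha>) - transfinite_iter F \<alpha>" for \<alpha> by metis
    have neq: "g \<alpha> \<noteq> g \<beta>" if "\<alpha> < \<beta>" for \<alpha> \<beta>
    proof -
      have "osuc \<alpha> \<le> \<beta>" using that by (metis less_osuc_iff not_le)
      then show ?thesis using g[of \<alpha>] g[of \<beta>] transfinite_iter_mono[OF assms, of "osuc \<alpha>" \<beta>] by auto
    qed
    have "inj g" by (rule injI) (metis neq linorder_neqE)
    moreover define h :: "'a literal \<Rightarrow> 'a list"
      where "h l = (case l of Pos A \<Rightarrow> [A] | Neg A \<Rightarrow> [A, A])" for l
    have "inj h" by (rule injI) (auto simp: h_def split: literal.splits)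
    ultimately have "inj (h \<circ> g)" by (simp add: inj_compose)
    then have "|UNIV :: 'a ordinal set| \<le>o |UNIV :: 'a list set|"
      using card_of_ordLeq[of "UNIV :: 'a ordinal set" "UNIV :: 'a list set"] by blast
    with card_ordinal_greater show False
      using not_ordLeq_ordLess by blast
  qed
  then obtain \<alpha> :: "'a ordinal" where "F (transfinite_iter F \<alpha>) = transfinite_iter F \<alpha>"
    by (auto simp: transfinite_iter_osuc)
  then have "lfp F \<subseteq> transfinite_iter F \<alpha>" by (simp add: lfp_lowerbound)
  moreover have "transfinite_iter F \<beta> \<subseteq> lfp F" for \<beta> :: "'a ordinal"
  proof (induct \<beta> rule: less_induct)
    case (less \<beta>)
    consider "\<beta> = 0" | \<gamma> where "\<beta> = osuc \<gamma>" | "\<beta> \<noteq> 0" "\<And>\<gamma>. \<beta> \<noteq> osuc \<gamma>" by blast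
    then show ?case
    proof cases
      case 2
      then have "F (transfinite_iter F \<gamma>) \<subseteq> F (lfp F)"
        using less[of \<gamma>] less_osuc assms by (auto dest: monoD)
      then show ?thesis using 2 lfp_fixpoint[OF assms] by (simp add: transfinite_iter_osuc)
    next
      case 3
      then show ?thesis using less by (auto simp: transfinite_iter_limit)
    qed (simp add: transfinite_iter_0)
  qed
  ultimately show ?thesis by blast
qed

lemma ordinal_family_bounded: "\<exists>\<alpha>. \<forall>A. (f :: 'a \<Rightarrow> 'a ordinal) A < \<alpha>"
proof (rule ccontr)
  assume "\<not> ?thesis"
  then have "\<exists>A. \<alpha> \<le> f A" for \<alpha> by (meson not_le)
  then have UN: "(\<Union>A. {.. f A}) = UNIV"
    by blast
  let ?L = "UNIV :: 'a list set" and ?r = "cardSuc |UNIV :: 'a list set|"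
  have init: "|{.. \<beta>}| \<le>o |?L|" for \<beta> :: "'a ordinal"
  proof -
    have "Rep_ordinal \<alpha> \<in> underS ?r (Rep_ordinal (osuc \<beta>))" if "\<alpha> \<le> \<beta>" for \<alpha>
    proof -
      from that have "\<alpha> < osuc \<beta>" by (simp only: less_osuc_iff)
      then show ?thesis
        unfolding underS_def less_ordinal_def less_eq_ordinal_def
        by (simp add: Rep_ordinal_inject)
    qed
    then have "Rep_ordinal ` {.. \<beta>} \<subseteq> underS ?r (Rep_ordinal (osuc \<beta>))"
      by blast
    moreover have "inj_on Rep_ordinal {.. \<beta>}"
      by (rule inj_onI) (simp only: Rep_ordinal_inject)
    ultimately have "|{.. \<beta>}| \<le>o |underS ?r (Rep_ordinal (osuc \<beta>))|"
      using card_of_ordLeq by blast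
    also have "|underS ?r (Rep_ordinal (osuc \<beta>))| <o ?r"
      by (rule card_of_underS[OF cardSuc_list_Card_order Rep_ordinal])
    finally have "|{.. \<beta>}| <o ?r" .
    then show ?thesis
      using cardSuc_ordLeq_ordLess[OF card_of_Card_order card_of_Card_order] by blast
  qed
  have "|UNIV :: 'a set| \<le>o |?L|"
    by (rule card_of_ordLeqI[where f = "\<lambda>A. [A]"]) (auto simp: inj_on_def)
  then have "|\<Union>A \<in> UNIV. {.. f A}| \<le>o |?L|"
    using init by (intro card_of_UNION_ordLeq_infinite) (simp_all add: infinite_UNIV_listI)
  with card_ordinal_greater show False
    unfolding UN using not_ordLeq_ordLess by blast
qed

unbundle no cardinal_syntax


section \<open>Level mapping, distance and generalized ultrametrics\<close>

definition level :: "'a set \<Rightarrow> 'a clause set \<Rightarrow> 'a set \<Rightarrow> 'a \<Rightarrow> 'a ordinal" where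
  "level B G I A = (LEAST \<alpha>.
     val3 (transfinite_iter (fitting_op B (fixpoint_completion G)) (osuc \<alpha>)) A = val2 I A)"

text \<open>The symbol \<open>2\<close> to the power \<open>-\<beta>\<close> is represented by \<^term>\<open>dual \<beta>\<close>, whose
  order is the reverse of that of the ordinals; \<^term>\<open>dual \<alpha>\<close> plays the role of the least
  element \<open>0\<close> for a level mapping with values below \<open>\<alpha>\<close>.\<close>

definition Gamma :: "'a ordinal \<Rightarrow> 'a ordinal dual set" where
  "Gamma \<alpha> = dual ` {.. \<alpha>}"

definition level_dist ::
  "'a set \<Rightarrow> ('a \<Rightarrow> 'a ordinal) \<Rightarrow> 'a ordinal \<Rightarrow> 'a set \<Rightarrow> 'a set \<Rightarrow> 'a ordinal dual" where
  "level_dist B l \<alpha> J K =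
     (if J = K then dual \<alpha> else dual (LEAST \<beta>. \<exists>A \<in> B. l A = \<beta> \<and> (A \<in> J) \<noteq> (A \<in> K)))"

definition rho ::
  "'a set \<Rightarrow> ('a \<Rightarrow> 'a ordinal) \<Rightarrow> 'a ordinal \<Rightarrow> 'a set \<Rightarrow> 'a set \<Rightarrow> 'a set \<Rightarrow> 'a ordinal dual" where
  "rho B l \<alpha> I J K = max (level_dist B l \<alpha> J I) (level_dist B l \<alpha> I K)"

definition dislocated_gen_ultrametric ::
  "'x set \<Rightarrow> 'g::order set \<Rightarrow> 'g \<Rightarrow> ('x \<Rightarrow> 'x \<Rightarrow> 'g) \<Rightarrow> bool" where
  "dislocated_gen_ultrametric X \<Gamma> z \<rho> \<longleftrightarrow>
     z \<in> \<Gamma> \<and> (\<forall>\<gamma> \<in> \<Gamma>. z \<le> \<gamma>) \<and>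
     (\<forall>x \<in> X. \<forall>y \<in> X. \<rho> x y \<in> \<Gamma>) \<and>
     (\<forall>x \<in> X. \<forall>y \<in> X. \<rho> x y = z \<longrightarrow> x = y) \<and>
     (\<forall>x \<in> X. \<forall>y \<in> X. \<rho> x y = \<rho> y x) \<and>
     (\<forall>x \<in> X. \<forall>y \<in> X. \<forall>w \<in> X. \<forall>\<gamma> \<in> \<Gamma>. \<rho> x y \<le> \<gamma> \<and> \<rho> y w \<le> \<gamma> \<longrightarrow> \<rho> x w \<le> \<gamma>)"

definition gball :: "'x set \<Rightarrow> ('x \<Rightarrow> 'x \<Rightarrow> 'g::order) \<Rightarrow> 'x \<Rightarrow> 'g \<Rightarrow> 'x set" where
  "gball X \<rho> x \<gamma> = {y \<in> X. \<rho> x y \<le> \<gamma>}"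

text \<open>Balls may be empty because \<open>\<rho> x x\<close> need not be the least element.\<close>

definition spherically_complete ::
  "'x set \<Rightarrow> 'g::order set \<Rightarrow> ('x \<Rightarrow> 'x \<Rightarrow> 'g) \<Rightarrow> bool" where
  "spherically_complete X \<Gamma> \<rho> \<longleftrightarrow>
     (\<forall>\<C>. \<C> \<noteq> {} \<and> subset.chain {gball X \<rho> x \<gamma> | x \<gamma>. x \<in> X \<and> \<gamma> \<in> \<Gamma> \<and> gball X \<rho> x \<gamma> \<noteq> {}} \<C>
        \<longrightarrow> \<Inter> \<C> \<noteq> {})"

definition strictly_contracting ::
  "'x set \<Rightarrow> ('x \<Rightarrow> 'x \<Rightarrow> 'g::order) \<Rightarrow> ('x \<Rightarrow> 'x) \<Rightarrow> bool" where
  "strictly_contracting X \<rho> f \<longleftrightarrow>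
     f ` X \<subseteq> X \<and> (\<forall>x \<in> X. \<forall>y \<in> X. x \<noteq> y \<longrightarrow> \<rho> (f x) (f y) < \<rho> x y)"

end

(* The well-founded model is the least fixed point of the Fitting operator of the fixpoint
   completion Q of P, and GL_P coincides with the immediate consequence operator of Q, whose
   clause bodies are purely negative. An atom of level gamma is decided by stage gamma + 1, that
   is, by negative literals over atoms of level less than gamma. Hence if J agrees with I on all
   levels less than gamma, then GL_P(J) agrees with I on all levels up to gamma, so each
   application of GL_P strictly decreases the distance to I. Spherical completeness holds because
   I lies in every nonempty ball. *)
theory Submission
  imports Defs
begin

section \<open>The fixpoint completion\<close>

text \<open>The operators admit only atoms of \<open>B\<close>, so clauses must not lead out of it.
  This is the only place where first-order syntax enters; the lemmas after it concern arbitrary sets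
  of clauses over \<open>B\<close>.\<close>

lemma grounding_subset_herbrand_base:
  fixes L :: "('f, 'p) language" and P :: "('p, 'f, 'v) atom clause set"
  assumes "normal_program L P" and "C \<in> grounding L P"
  shows "atoms C \<subseteq> herbrand_base L"
proof -
  have vars_subst: "fterm_vars (subst_fterm \<sigma> t) = (\<Union>x \<in> fterm_vars t. fterm_vars (\<sigma> x))"
    for \<sigma> :: "'v \<Rightarrow> ('f, 'v) fterm" and t :: "('f, 'v) fterm"
    by (induct t) auto
  have wf_subst: "wf_fterm L t \<Longrightarrow> \<forall>x \<in> fterm_vars t. wf_fterm L (\<sigma> x) \<Longrightarrow>
      wf_fterm L (subst_fterm \<sigma> t)" for \<sigma> :: "'v \<Rightarrow> ('f, 'v) fterm" and t :: "('f, 'v) fterm"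
    by (induct t) auto
  obtain D \<sigma> where C: "C = map_clause (subst_atom \<sigma>) D" and "D \<in> P"
    and \<sigma>: "\<forall>A \<in> atoms D. \<forall>x \<in> atom_vars A. \<sigma> x \<in> ground_terms L"
    using assms(2) unfolding grounding_def by blast
  have "subst_atom \<sigma> A \<in> herbrand_base L" if "A \<in> atoms D" for A
  proof -
    obtain p ts where A: "A = Atom p ts" by (cases A)
    have "wf_atom L A"
      using assms(1) \<open>D \<in> P\<close> that unfolding normal_program_def by blast
    moreover have "\<forall>t \<in> set ts. \<forall>x \<in> fterm_vars t. wf_fterm L (\<sigma> x) \<and> fterm_vars (\<sigma> x) = {}"
      using \<sigma> that by (fastforce simp: A ground_terms_def)
    ultimately show ?thesis
      by (auto simp: A herbrand_base_def vars_subst intro!: wf_subst)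
  qed
  then show ?thesis
    by (auto simp: C clause.set_map)
qed

lemma set_pos_body: "set (pos_body C) = {A. Pos A \<in> set (body C)}"
  by (force simp: pos_body_def split: literal.splits)

lemma set_neg_body: "set (neg_body C) = {A. Neg A \<in> set (body C)}"
  by (force simp: neg_body_def split: literal.splits)

lemma head_in_atoms: "head C \<in> atoms C"
  by (cases C) simp

lemma pos_body_in_atoms: "A \<in> set (pos_body C) \<Longrightarrow> A \<in> atoms C"
  by (cases C) (force simp: set_pos_body)

lemma T_quasi_mono: "S \<subseteq> S' \<Longrightarrow> T_quasi G S \<subseteq> T_quasi G S'"
  unfolding T_quasi_def by (blast intro: list_all2_mono)

lemma T_quasi_funpow_mono: "m \<le> n \<Longrightarrow> (T_quasi G ^^ m) {} \<subseteq> (T_quasi G ^^ n) {}"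
  by (rule funpow_decreasing) (simp_all add: monoI T_quasi_mono)

text \<open>Rule induction that hides the finite stages: every clause of the completion arises by
  splicing bodies of earlier completion clauses into a clause of \<open>G\<close>.\<close>

lemma fixpoint_completion_induct [consumes 1, case_names clause]:
  assumes "Clause A b \<in> fixpoint_completion G"
    and step: "\<And>C bs. C \<in> G \<Longrightarrow>
      list_all2 (\<lambda>A b. Clause A b \<in> fixpoint_completion G \<and> Q A b) (pos_body C) bs \<Longrightarrow>
      Q (head C) (concat bs @ map Neg (neg_body C))"
  shows "Q A b"
proof -
  have "Clause A b \<in> (T_quasi G ^^ k) {} \<Longrightarrow> Q A b" for k A b
  proof (induct k arbitrary: A b)
    case (Suc k)
    then have "Clause A b \<in> T_quasi G ((T_quasi G ^^ k) {})"
      by simp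
    then obtain C bs where "C \<in> G" "A = head C" "b = concat bs @ map Neg (neg_body C)"
      "list_all2 (\<lambda>A b. Clause A b \<in> (T_quasi G ^^ k) {}) (pos_body C) bs"
      unfolding T_quasi_def by blast
    moreover from this(4) have
      "list_all2 (\<lambda>A b. Clause A b \<in> fixpoint_completion G \<and> Q A b) (pos_body C) bs"
      by (rule list_all2_mono) (use Suc.hyps in \<open>auto simp: fixpoint_completion_def\<close>)
    ultimately show ?case
      using step by blast
  qed simp
  with assms(1) show ?thesis
    unfolding fixpoint_completion_def by blast
qed

text \<open>The introduction rule matching the induction above. The predicate \<open>p\<close>
  travels with the chosen bodies, so the rule serves equally for bodies that are true, not blocked,
  or compatible with \<open>J\<close>.\<close>

lemma fixpoint_completion_clause:
  assumes "C \<in> G"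
    and "\<And>A. A \<in> set (pos_body C) \<Longrightarrow> \<exists>b. Clause A b \<in> fixpoint_completion G \<and> Ball (set b) p"
    and "\<And>A. A \<in> set (neg_body C) \<Longrightarrow> p (Neg A)"
  shows "\<exists>b. Clause (head C) b \<in> fixpoint_completion G \<and> Ball (set b) p"
proof -
  \<comment> \<open>The bodies for different atoms may appear at different stages. Since
    \<open>As\<close> is finite and the stages increase, a maximum gives one common stage.\<close>
  have "\<exists>bs k. list_all2 (\<lambda>A b. Clause A b \<in> (T_quasi G ^^ k) {} \<and> Ball (set b) p) As bs"
    if "\<forall>A \<in> set As. \<exists>b. Clause A b \<in> fixpoint_completion G \<and> Ball (set b) p" for As
    using that
  proof (induct As)
    case (Cons A As)
    then obtain bs k b m
      where bs: "list_all2 (\<lambda>A b. Clause A b \<in> (T_quasi G ^^ k) {} \<and> Ball (set b) p) As bs"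
        and "Clause A b \<in> (T_quasi G ^^ m) {}" and "Ball (set b) p"
      unfolding fixpoint_completion_def by auto
    moreover have "(T_quasi G ^^ m) {} \<subseteq> (T_quasi G ^^ max k m) {}"
      "(T_quasi G ^^ k) {} \<subseteq> (T_quasi G ^^ max k m) {}"
      by (rule T_quasi_funpow_mono, simp)+
    ultimately have
      "list_all2 (\<lambda>A b. Clause A b \<in> (T_quasi G ^^ max k m) {} \<and> Ball (set b) p) (A # As) (b # bs)"
      using list_all2_mono[OF bs, of "\<lambda>A b. Clause A b \<in> (T_quasi G ^^ max k m) {} \<and> Ball (set b) p"]
      by auto
    then show ?case by blast
  qed auto
  with assms(2) obtain bs k where
    bs: "list_all2 (\<lambda>A b. Clause A b \<in> (T_quasi G ^^ k) {} \<and> Ball (set b) p) (pos_body C) bs"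
    by blast
  have "list_all2 (\<lambda>A b. Clause A b \<in> (T_quasi G ^^ k) {}) (pos_body C) bs"
    using bs by (rule list_all2_mono) blast
  with assms(1) have "Clause (head C) (concat bs @ map Neg (neg_body C)) \<in> (T_quasi G ^^ Suc k) {}"
    unfolding funpow.simps o_apply T_quasi_def by blast
  moreover have "Ball (set b) p" if "b \<in> set bs" for b
    using bs that by (auto simp: list_all2_conv_all_nth in_set_conv_nth)
  then have "Ball (set (concat bs @ map Neg (neg_body C))) p"
    using assms(3) by auto
  ultimately show ?thesis
    unfolding fixpoint_completion_def by blast
qed

lemma fixpoint_completion_body:
  assumes "Clause A b \<in> fixpoint_completion G"
  shows "set b \<subseteq> range Neg"
  using assms
proof (induct rule: fixpoint_completion_induct)
  case (clause C bs)
  then show ?case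
    by (fastforce simp: list_all2_conv_all_nth in_set_conv_nth)
qed

lemma list_all2_partner:
  assumes "list_all2 Q xs ys" and "x \<in> set xs"
  obtains y where "y \<in> set ys" "Q x y"
proof -
  obtain i where "i < length xs" "x = xs ! i"
    using assms(2) by (auto simp: in_set_conv_nth)
  with assms(1) show thesis
    by (intro that[of "ys ! i"]) (auto simp: list_all2_conv_all_nth)
qed

section \<open>The Gelfond-Lifschitz operator in terms of the completion\<close>

lemma mono_T_op: "mono (T_op B R)"
  by (rule monoI) (auto simp: T_op_def)

lemma T_op_funpow_mono: "m \<le> n \<Longrightarrow> (T_op B R ^^ m) {} \<subseteq> (T_op B R ^^ n) {}"
  by (rule funpow_decreasing[OF _ mono_T_op])

text \<open>Finitely many premises are all derived by some finite stage, so iteration through the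
  natural numbers already reaches closure.\<close>

lemma fix_T_closed:
  assumes "Clause A (map Pos As) \<in> R" and "A \<in> B" and "set As \<subseteq> fix_T B R"
  shows "A \<in> fix_T B R"
proof -
  have "\<exists>n. set As \<subseteq> (T_op B R ^^ n) {}"
    using assms(3)
  proof (induct As)
    case (Cons A As)
    then obtain m n where "set As \<subseteq> (T_op B R ^^ m) {}" "A \<in> (T_op B R ^^ n) {}"
      unfolding fix_T_def by auto
    moreover have "(T_op B R ^^ m) {} \<subseteq> (T_op B R ^^ max m n) {}"
      "(T_op B R ^^ n) {} \<subseteq> (T_op B R ^^ max m n) {}"
      by (rule T_op_funpow_mono, simp)+
    ultimately show ?case by (intro exI[of _ "max m n"]) auto
  qed simp
  then obtain n where "set As \<subseteq> (T_op B R ^^ n) {}" ..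
  with assms(1,2) have "A \<in> (T_op B R ^^ Suc n) {}"
    by (auto simp: T_op_def)
  then show ?thesis
    unfolding fix_T_def by blast
qed

lemma GL_op_subset: "GL_op B G J \<subseteq> B"
proof -
  have "(T_op B R ^^ n) {} \<subseteq> B" for R n
    by (cases n) (auto simp: T_op_def)
  then show ?thesis
    unfolding GL_op_def fix_T_def by blast
qed

text \<open>A completion clause records the negative literals used in a whole derivation of its
  head. Unfolding a derivation in the transformed program yields such a clause, and conversely each
  unfolding replays as a derivation as long as no recorded atom lies in \<open>J\<close>.\<close>

lemma GL_op_iff:
  fixes G :: "'a clause set"
  assumes G: "\<And>C. C \<in> G \<Longrightarrow> atoms C \<subseteq> B"
  shows "A \<in> GL_op B G J \<longleftrightarrow>
    (\<exists>b. Clause A b \<in> fixpoint_completion G \<and> (\<forall>l \<in> set b. l \<notin> Neg ` J))"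
proof
  have "A \<in> (T_op B (GL_transform G J) ^^ n) {} \<Longrightarrow>
      \<exists>b. Clause A b \<in> fixpoint_completion G \<and> (\<forall>l \<in> set b. l \<notin> Neg ` J)" for n A
  proof (induct n arbitrary: A)
    case (Suc n)
    then obtain As where "Clause A (map Pos As) \<in> GL_transform G J"
      "set As \<subseteq> (T_op B (GL_transform G J) ^^ n) {}"
      unfolding funpow.simps o_apply T_op_def[of B _ "(_ ^^ _) {}"] by blast
    \<comment> \<open>Needed to identify \<open>As\<close> with \<open>pos_body C\<close> from
      equality of their images under \<open>Pos\<close>.\<close>
    moreover have "inj (Pos :: 'a \<Rightarrow> 'a literal)"
      by (rule injI) simp
    ultimately obtain C where "A = head C" "C \<in> G" "set (neg_body C) \<inter> J = {}"
      "set (pos_body C) \<subseteq> (T_op B (GL_transform G J) ^^ n) {}"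
      by (auto simp: GL_transform_def inj_map_eq_map)
    show ?case
      unfolding \<open>A = head C\<close>
    proof (rule fixpoint_completion_clause[OF \<open>C \<in> G\<close>])
      show "\<exists>b. Clause A' b \<in> fixpoint_completion G \<and> (\<forall>l \<in> set b. l \<notin> Neg ` J)"
        if "A' \<in> set (pos_body C)" for A'
        using that Suc.hyps \<open>set (pos_body C) \<subseteq> _\<close> by blast
      show "Neg A' \<notin> Neg ` J" if "A' \<in> set (neg_body C)" for A'
        using that \<open>set (neg_body C) \<inter> J = {}\<close> by auto
    qed
  qed simp
  then show "A \<in> GL_op B G J \<Longrightarrow>
      \<exists>b. Clause A b \<in> fixpoint_completion G \<and> (\<forall>l \<in> set b. l \<notin> Neg ` J)"
    unfolding GL_op_def fix_T_def by blast
next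
  have "(\<forall>l \<in> set b. l \<notin> Neg ` J) \<longrightarrow> A \<in> GL_op B G J"
    if "Clause A b \<in> fixpoint_completion G" for b
    using that
  proof (induct rule: fixpoint_completion_induct)
    case (clause C bs)
    show ?case
    proof
      assume J: "\<forall>l \<in> set (concat bs @ map Neg (neg_body C)). l \<notin> Neg ` J"
      then have "Clause (head C) (map Pos (pos_body C)) \<in> GL_transform G J"
        using clause(1) by (auto simp: GL_transform_def)
      moreover have "head C \<in> B"
        using G[OF clause(1)] head_in_atoms by blast
      moreover have "set (pos_body C) \<subseteq> GL_op B G J"
      proof
        fix A assume "A \<in> set (pos_body C)"
        with clause(2) show "A \<in> GL_op B G J"
          by (rule list_all2_partner) (use J in auto)
      qed
      ultimately show "head C \<in> GL_op B G J"
        unfolding GL_op_def by (rule fix_T_closed)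
    qed
  qed
  then show "\<exists>b. Clause A b \<in> fixpoint_completion G \<and> (\<forall>l \<in> set b. l \<notin> Neg ` J) \<Longrightarrow>
      A \<in> GL_op B G J"
    by blast
qed

section \<open>The well-founded model as a Fitting model\<close>

lemma mono_fitting_op: "mono (fitting_op B R)"
  by (rule monoI) (auto simp: fitting_op_def, blast+)

lemma Pos_in_fitting_op:
  "Pos A \<in> fitting_op B R J \<longleftrightarrow> A \<in> B \<and> (\<exists>b. Clause A b \<in> R \<and> set b \<subseteq> J)"
proof -
  have "(\<exists>C \<in> R. head C = A \<and> set (body C) \<subseteq> J) \<longleftrightarrow> (\<exists>b. Clause A b \<in> R \<and> set b \<subseteq> J)"
    by (metis clause.collapse clause.sel)
  then show ?thesis
    by (simp add: fitting_op_def)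
qed

lemma Neg_in_fitting_op:
  "Neg A \<in> fitting_op B R J \<longleftrightarrow>
    A \<in> B \<and> (\<forall>b. Clause A b \<in> R \<longrightarrow> (\<exists>l \<in> set b. compl_lit l \<in> J))"
proof -
  have "(\<forall>C \<in> R. head C = A \<longrightarrow> Q (body C)) \<longleftrightarrow> (\<forall>b. Clause A b \<in> R \<longrightarrow> Q b)" for Q
    by (metis clause.collapse clause.sel)
  from this[of "\<lambda>b. \<exists>l \<in> set b. compl_lit l \<in> J"] show ?thesis
    by (simp add: fitting_op_def)
qed

text \<open>Each least fixed point is shown to be closed under the other operator. The link between
  the negative parts is that unfolding turns unfoundedness into blocked bodies, while the atoms with
  only blocked completion clauses form an unfounded set.\<close>

lemma well_founded_model_eq_lfp_fitting_op:
  assumes G: "\<And>C. C \<in> G \<Longrightarrow> atoms C \<subseteq> B"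
  shows "well_founded_model B G = lfp (fitting_op B (fixpoint_completion G))"
    (is "?W = lfp (fitting_op B ?Q)")
proof (rule antisym)
  let ?M = "lfp (fitting_op B ?Q)"
  have M: "fitting_op B ?Q ?M = ?M"
    by (rule lfp_fixpoint[OF mono_fitting_op])
  have "l \<in> ?M" if "l \<in> W_op B G ?M" for l
  proof (cases l)
    case (Pos A)
    then obtain C where C: "C \<in> G" "A = head C" "set (body C) \<subseteq> ?M" "A \<in> B"
      using \<open>l \<in> _\<close> by (auto simp: W_op_def)
    have "\<exists>b. Clause (head C) b \<in> ?Q \<and> (\<forall>l \<in> set b. l \<in> ?M)"
    proof (rule fixpoint_completion_clause[OF \<open>C \<in> G\<close>])
      fix A' assume "A' \<in> set (pos_body C)"
      then have "Pos A' \<in> fitting_op B ?Q ?M"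
        using C(3) M by (auto simp: set_pos_body)
      then show "\<exists>b. Clause A' b \<in> ?Q \<and> (\<forall>l \<in> set b. l \<in> ?M)"
        unfolding Pos_in_fitting_op by blast
    qed (use C(3) in \<open>auto simp: set_neg_body\<close>)
    then have "Pos A \<in> fitting_op B ?Q ?M"
      unfolding Pos_in_fitting_op using C by blast
    with M Pos show ?thesis by simp
  next
    case (Neg A)
    then obtain U where U: "unfounded B G ?M U" "A \<in> U"
      using \<open>l \<in> _\<close> by (auto simp: W_op_def greatest_unfounded_eq_Union)
    \<comment> \<open>The induction eliminates the escape through an atom \<open>A'\<close> of
      \<open>U\<close>: the body spliced in for \<open>A'\<close> is itself blocked. If
      \<open>A'\<close> is outside \<open>U\<close>, it is false in \<open>?M\<close>, and the
      fixpoint equation blocks that body as well.\<close>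
    have "A \<in> U \<longrightarrow> (\<exists>l \<in> set b. compl_lit l \<in> ?M)" if "Clause A b \<in> ?Q" for A b
      using that
    proof (induct rule: fixpoint_completion_induct)
      case (clause C bs)
      show ?case
      proof
        assume "head C \<in> U"
        with U(1) clause(1) obtain l where l: "l \<in> set (body C)"
          "compl_lit l \<in> ?M \<or> (\<exists>A' \<in> U. l = Pos A')"
          unfolding unfounded_def by blast
        show "\<exists>l \<in> set (concat bs @ map Neg (neg_body C)). compl_lit l \<in> ?M"
        proof (cases l)
          case (Neg A')
          then show ?thesis
            using l by (force simp: set_neg_body)
        next
          case (Pos A')
          with l(1) have "A' \<in> set (pos_body C)"
            by (simp add: set_pos_body)
          with clause(2) obtain b where b: "b \<in> set bs" "Clause A' b \<in> ?Q"
            "A' \<in> U \<longrightarrow> (\<exists>l \<in> set b. compl_lit l \<in> ?M)"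
            by (rule list_all2_partner) blast
          have "\<exists>l \<in> set b. compl_lit l \<in> ?M"
          proof (cases "A' \<in> U")
            case True
            with b(3) show ?thesis by blast
          next
            case False
            with l(2) Pos have "Neg A' \<in> fitting_op B ?Q ?M"
              using M by auto
            with b(2) show ?thesis
              unfolding Neg_in_fitting_op by blast
          qed
          with b(1) show ?thesis by auto
        qed
      qed
    qed
    with U have "Neg A \<in> fitting_op B ?Q ?M"
      unfolding Neg_in_fitting_op unfounded_def by blast
    with M Neg show ?thesis by simp
  qed
  then show "?W \<subseteq> ?M"
    unfolding well_founded_model_def by (intro lfp_lowerbound) blast
next
  have W: "W_op B G ?W = ?W"
    unfolding well_founded_model_def by (rule lfp_fixpoint[OF mono_W_op])
  have "l \<in> ?W" if l: "l \<in> fitting_op B ?Q ?W" for l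
  proof (cases l)
    case (Pos A)
    then obtain b where "Clause A b \<in> ?Q" "set b \<subseteq> ?W"
      using l by (auto simp: Pos_in_fitting_op)
    moreover have "set b \<subseteq> ?W \<longrightarrow> Pos A \<in> ?W" if "Clause A b \<in> ?Q" for b
      using that
    proof (induct rule: fixpoint_completion_induct)
      case (clause C bs)
      show ?case
      proof
        assume sub: "set (concat bs @ map Neg (neg_body C)) \<subseteq> ?W"
        have "l \<in> ?W" if "l \<in> set (body C)" for l
        proof (cases l)
          case (Pos A')
          with that have "A' \<in> set (pos_body C)"
            by (simp add: set_pos_body)
          with clause(2) show ?thesis
            by (rule list_all2_partner) (use Pos sub in auto)
        qed (use that sub in \<open>auto simp: set_neg_body\<close>)
        moreover have "head C \<in> B"
          using G[OF clause(1)] head_in_atoms by blast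
        ultimately have "Pos (head C) \<in> W_op B G ?W"
          using clause(1) unfolding W_op_def by blast
        with W show "Pos (head C) \<in> ?W" by simp
      qed
    qed
    ultimately show ?thesis using Pos by blast
  next
    case (Neg A)
    \<comment> \<open>These are exactly the atoms that the Fitting operator makes false at
      \<open>?W\<close>.\<close>
    let ?U = "{A \<in> B. \<forall>b. Clause A b \<in> ?Q \<longrightarrow> (\<exists>l \<in> set b. compl_lit l \<in> ?W)}"
    have "\<exists>l \<in> set (body C). compl_lit l \<in> ?W \<or> (\<exists>A' \<in> ?U. l = Pos A')"
      if "head C \<in> ?U" "C \<in> G" for C
    proof (rule ccontr)
      \<comment> \<open>Every positive atom of \<open>C\<close> is then outside \<open>?U\<close>
        and has an unblocked completion clause. Splicing these in gives an unblocked clause for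
        \<open>head C\<close>, which contradicts \<open>head C\<close> being in
        \<open>?U\<close>.\<close>
      assume neg: "\<not> ?thesis"
      have "\<exists>b. Clause (head C) b \<in> ?Q \<and> (\<forall>l \<in> set b. compl_lit l \<notin> ?W)"
      proof (rule fixpoint_completion_clause[OF \<open>C \<in> G\<close>])
        fix A' assume A': "A' \<in> set (pos_body C)"
        with G[OF \<open>C \<in> G\<close>] have "A' \<in> B"
          using pos_body_in_atoms by fastforce
        with A' neg show "\<exists>b. Clause A' b \<in> ?Q \<and> (\<forall>l \<in> set b. compl_lit l \<notin> ?W)"
          by (auto simp: set_pos_body)
      qed (use neg in \<open>auto simp: set_neg_body\<close>)
      with \<open>head C \<in> ?U\<close> show False by blast
    qed
    then have "unfounded B G ?W ?U"
      unfolding unfounded_def by blast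
    moreover have "A \<in> ?U"
      using l Neg by (simp add: Neg_in_fitting_op)
    ultimately have "Neg A \<in> W_op B G ?W"
      unfolding W_op_def greatest_unfounded_eq_Union by blast
    with W Neg show ?thesis by simp
  qed
  then show "lfp (fitting_op B ?Q) \<subseteq> ?W"
    by (intro lfp_lowerbound) blast
qed

section \<open>The level mapping and its metric\<close>

text \<open>Totality of the reversed order makes the library facts about \<open>max\<close>, and
  hence about \<open>rho\<close>, available.\<close>

instance dual :: (linorder) linorder
  by standard (auto simp: dual_less_eq_iff)

text \<open>Because \<open>dual\<close> reverses the order, a bound on the distance is a lower bound
  on the first level of disagreement. The condition \<open>\<beta> \<le> \<alpha>\<close> covers
  \<open>J = K\<close>, where the distance is \<open>dual \<alpha>\<close>.\<close>

lemma level_dist_le_iff: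
  assumes "\<forall>A \<in> B. l A < \<alpha>" and "J \<subseteq> B" and "K \<subseteq> B" and "\<beta> \<le> \<alpha>"
  shows "level_dist B l \<alpha> J K \<le> dual \<beta> \<longleftrightarrow> (\<forall>A \<in> B. l A < \<beta> \<longrightarrow> (A \<in> J \<longleftrightarrow> A \<in> K))"
proof (cases "J = K")
  case True
  then show ?thesis
    using assms(4) by (simp add: level_dist_def)
next
  case False
  let ?D = "\<lambda>\<beta>. \<exists>A \<in> B. l A = \<beta> \<and> (A \<in> J) \<noteq> (A \<in> K)"
  have "\<exists>\<beta>. ?D \<beta>"
    using False assms(2,3) by blast
  then have D: "?D (LEAST \<beta>. ?D \<beta>)"
    by (rule LeastI_ex)
  have "\<beta> \<le> (LEAST \<beta>. ?D \<beta>) \<longleftrightarrow> (\<forall>\<gamma>. ?D \<gamma> \<longrightarrow> \<beta> \<le> \<gamma>)"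
    using D Least_le[of ?D] by (meson order_trans)
  then show ?thesis
    using False unfolding level_dist_def by (auto simp: not_less[symmetric])
qed

lemma level_dist_in_Gamma:
  assumes "\<forall>A \<in> B. l A < \<alpha>" and "J \<subseteq> B" and "K \<subseteq> B"
  shows "level_dist B l \<alpha> J K \<in> Gamma \<alpha>"
proof (cases "J = K")
  case False
  let ?D = "\<lambda>\<beta>. \<exists>A \<in> B. l A = \<beta> \<and> (A \<in> J) \<noteq> (A \<in> K)"
  have "\<exists>\<beta>. ?D \<beta>"
    using False assms(2,3) by blast
  then have "?D (LEAST \<beta>. ?D \<beta>)"
    by (rule LeastI_ex)
  then have "(LEAST \<beta>. ?D \<beta>) < \<alpha>"
    using assms(1) by metis
  with False show ?thesis
    by (simp add: level_dist_def Gamma_def)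
qed (simp add: level_dist_def Gamma_def)

text \<open>All levels lie strictly below \<open>\<alpha>\<close>, so agreement below
  \<open>\<alpha>\<close> is agreement everywhere.\<close>

lemma level_dist_le_zero_iff:
  assumes "\<forall>A \<in> B. l A < \<alpha>" and "J \<subseteq> B" and "K \<subseteq> B"
  shows "level_dist B l \<alpha> J K \<le> dual \<alpha> \<longleftrightarrow> J = K"
proof -
  have "(\<forall>A \<in> B. l A < \<alpha> \<longrightarrow> (A \<in> J \<longleftrightarrow> A \<in> K)) \<longleftrightarrow> J = K"
    using assms by auto
  then show ?thesis
    unfolding level_dist_le_iff[OF assms order_refl] .
qed

lemma level_dist_commute: "level_dist B l \<alpha> J K = level_dist B l \<alpha> K J"
  unfolding level_dist_def by (simp add: eq_commute)

text \<open>The bound separates into conditions on \<open>J\<close> and on \<open>K\<close> alone,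
  both relative to \<open>I\<close>; the strong triangle inequality becomes a matter of
  propositional logic.\<close>

lemma rho_le_iff:
  "rho B l \<alpha> I J K \<le> \<gamma> \<longleftrightarrow> level_dist B l \<alpha> J I \<le> \<gamma> \<and> level_dist B l \<alpha> K I \<le> \<gamma>"
  by (simp add: rho_def level_dist_commute[of B l \<alpha> I])

lemma dislocated_gen_ultrametric_rho:
  assumes l: "\<forall>A \<in> B. l A < \<alpha>" and "I \<subseteq> B"
  shows "dislocated_gen_ultrametric (Pow B) (Gamma \<alpha>) (dual \<alpha>) (rho B l \<alpha> I)"
proof -
  have "rho B l \<alpha> I J K \<in> Gamma \<alpha>" if "J \<in> Pow B" "K \<in> Pow B" for J K
    using level_dist_in_Gamma[OF l] that \<open>I \<subseteq> B\<close> by (simp add: rho_def max_def)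
  moreover have "J = K" if "J \<in> Pow B" "K \<in> Pow B" "rho B l \<alpha> I J K = dual \<alpha>" for J K
    using rho_le_iff[of B l \<alpha> I J K "dual \<alpha>"] that level_dist_le_zero_iff[OF l] \<open>I \<subseteq> B\<close> by auto
  moreover have "rho B l \<alpha> I J K = rho B l \<alpha> I K J" for J K
    by (simp add: rho_def level_dist_commute[of B l \<alpha> I] max.commute)
  ultimately show ?thesis
    unfolding dislocated_gen_ultrametric_def rho_le_iff by (auto simp: Gamma_def)
qed

lemma spherically_complete_rho:
  assumes l: "\<forall>A \<in> B. l A < \<alpha>" and "I \<subseteq> B"
  shows "spherically_complete (Pow B) (Gamma \<alpha>) (rho B l \<alpha> I)"
proof -
  have "I \<in> gball (Pow B) (rho B l \<alpha> I) J \<gamma>"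
    if "\<gamma> \<in> Gamma \<alpha>" "gball (Pow B) (rho B l \<alpha> I) J \<gamma> \<noteq> {}" for J \<gamma>
  proof -
    \<comment> \<open>Any member of the ball forces its centre to be within \<open>\<gamma>\<close>
      of \<open>I\<close>.\<close>
    have "level_dist B l \<alpha> J I \<le> \<gamma>"
      using that(2) by (auto simp: gball_def rho_le_iff)
    moreover have "level_dist B l \<alpha> I I \<le> \<gamma>"
      using that(1) by (auto simp: level_dist_def Gamma_def)
    ultimately show ?thesis
      using \<open>I \<subseteq> B\<close> by (simp add: gball_def rho_le_iff)
  qed
  then have "I \<in> \<Inter> \<C>"
    if "subset.chain {gball (Pow B) (rho B l \<alpha> I) J \<gamma> | J \<gamma>.
      J \<in> Pow B \<and> \<gamma> \<in> Gamma \<alpha> \<and> gball (Pow B) (rho B l \<alpha> I) J \<gamma> \<noteq> {}} \<C>" for \<C>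
    using that unfolding subset_chain_def by blast
  then show ?thesis
    unfolding spherically_complete_def by blast
qed

text \<open>Zero and limit stages contribute nothing new, so every element enters at a successor
  stage. This matches \<open>level\<close>, which only inspects stages of the form
  \<open>osuc \<delta>\<close>.\<close>

lemma transfinite_iter_memE:
  assumes "x \<in> transfinite_iter F \<gamma>"
  obtains \<delta> where "\<delta> < \<gamma>" "x \<in> transfinite_iter F (osuc \<delta>)"
proof -
  have "\<exists>\<delta> < \<gamma>. x \<in> transfinite_iter F (osuc \<delta>)"
    using assms
  proof (induct \<gamma> rule: less_induct)
    case (less \<gamma>)
    consider "\<gamma> = 0" | \<delta> where "\<gamma> = osuc \<delta>" | "\<gamma> \<noteq> 0" "\<And>\<delta>. \<gamma> \<noteq> osuc \<delta>" by blast
    then show ?case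
    proof cases
      case 1
      with less.prems show ?thesis by (simp add: transfinite_iter_0)
    next
      case 2
      with less.prems less_osuc show ?thesis by blast
    next
      case 3
      with less show ?thesis
        by (auto simp: transfinite_iter_limit) (meson less_trans)
    qed
  qed
  with that show thesis by blast
qed

lemma transfinite_iter_le_lfp:
  fixes F :: "'b set \<Rightarrow> 'b set" and \<gamma> :: "'a ordinal"
  assumes "mono F"
  shows "transfinite_iter F \<gamma> \<subseteq> lfp F"
proof (induct \<gamma> rule: less_induct)
  case (less \<gamma>)
  show ?case
  proof
    fix x assume "x \<in> transfinite_iter F \<gamma>"
    then obtain \<delta> where "\<delta> < \<gamma>" "x \<in> F (transfinite_iter F \<delta>)"
      by (rule transfinite_iter_memE) (simp add: transfinite_iter_osuc)
    with less[of \<delta>] assms show "x \<in> lfp F"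
      using lfp_fixpoint[OF assms] by (metis monoD subsetD)
  qed
qed

text \<open>Inside a total model a set of literals is consistent, so the order of the tests in
  \<open>val3\<close> is immaterial and the equation defining \<open>level\<close> becomes
  membership of a single literal.\<close>

lemma val3_total:
  assumes "J \<subseteq> Pos ` I \<union> Neg ` (B - I)"
  shows "val3 J A = val2 I A \<longleftrightarrow> (if A \<in> I then Pos A \<in> J else Neg A \<in> J)"
proof -
  have "Pos A \<in> J \<Longrightarrow> A \<in> I" "Neg A \<in> J \<Longrightarrow> A \<notin> I"
    using assms by blast+
  then show ?thesis
    by (simp add: val3_def val2_def)
qed

section \<open>Fitting stages and levels under a total well-founded model\<close>

context
  fixes B :: "'a set" and G :: "'a clause set" and I :: "'a set"
  assumes G: "\<And>C. C \<in> G \<Longrightarrow> atoms C \<subseteq> B"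
    and I: "I \<subseteq> B"
    and total: "well_founded_model B G = Pos ` I \<union> Neg ` (B - I)"
begin

text \<open>The annotation fixes the index type to the one used by \<open>level\<close>;
  \<open>transfinite_iter\<close> alone would leave it independent of the atom type.\<close>

abbreviation "stage \<equiv>
  transfinite_iter (fitting_op B (fixpoint_completion G)) :: 'a ordinal \<Rightarrow> 'a literal set"

lemma lfp_fitting_op_eq: "lfp (fitting_op B (fixpoint_completion G)) = Pos ` I \<union> Neg ` (B - I)"
  using well_founded_model_eq_lfp_fitting_op[of G B] G total by simp

lemma stage_subset: "stage \<gamma> \<subseteq> Pos ` I \<union> Neg ` (B - I)"
  unfolding lfp_fitting_op_eq[symmetric]
  by (rule transfinite_iter_le_lfp[OF mono_fitting_op])

text \<open>The \<open>LEAST\<close> in \<open>level\<close> is attained: some stage is the whole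
  model, and the literal for \<open>A\<close> entered it at a successor stage.\<close>

lemma level_decided:
  assumes "A \<in> B"
  shows "if A \<in> I then Pos A \<in> stage (osuc (level B G I A)) else Neg A \<in> stage (osuc (level B G I A))"
proof -
  obtain \<gamma> where "stage \<gamma> = Pos ` I \<union> Neg ` (B - I)"
    unfolding lfp_fitting_op_eq[symmetric] using transfinite_iter_closure[OF mono_fitting_op] by blast
  with assms have "\<exists>l \<in> stage \<gamma>. l = (if A \<in> I then Pos A else Neg A)"
    by auto
  then obtain \<delta> where "(if A \<in> I then Pos A else Neg A) \<in> stage (osuc \<delta>)"
    using transfinite_iter_memE by metis
  then have "val3 (stage (osuc \<delta>)) A = val2 I A"
    unfolding val3_total[OF stage_subset] by (simp split: if_splits)
  then have "val3 (stage (osuc (level B G I A))) A = val2 I A"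
    unfolding level_def by (rule LeastI)
  then show ?thesis
    unfolding val3_total[OF stage_subset] .
qed

text \<open>A literal in \<open>stage \<gamma>\<close> already occurs in some
  \<open>stage (osuc \<delta>)\<close> with \<open>\<delta> < \<gamma>\<close>, so its atom has
  level at most \<open>\<delta>\<close>, strictly below \<open>\<gamma>\<close>. There
  \<open>J\<close> agrees with \<open>I\<close>.\<close>

lemma stage_agrees:
  assumes J: "\<forall>A \<in> B. level B G I A < \<gamma> \<longrightarrow> (A \<in> J \<longleftrightarrow> A \<in> I)"
  shows "Neg A \<in> stage \<gamma> \<Longrightarrow> A \<notin> J" and "Pos A \<in> stage \<gamma> \<Longrightarrow> A \<in> J"
proof -
  have "A \<in> B \<and> level B G I A < \<gamma> \<and> (A \<in> I \<longleftrightarrow> l = Pos A)"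
    if l: "l = Pos A \<or> l = Neg A" "l \<in> stage \<gamma>" for l
  proof -
    obtain \<delta> where \<delta>: "\<delta> < \<gamma>" "l \<in> stage (osuc \<delta>)"
      using l(2) by (rule transfinite_iter_memE)
    have A: "A \<in> B" and sgn: "A \<in> I \<longleftrightarrow> l = Pos A"
      using stage_subset[of \<gamma>] l I by auto
    have "val3 (stage (osuc \<delta>)) A = val2 I A"
      unfolding val3_total[OF stage_subset] using sgn l(1) \<delta>(2) by auto
    then have "level B G I A \<le> \<delta>"
      unfolding level_def by (rule Least_le)
    with A sgn \<delta>(1) show ?thesis by simp
  qed
  with J show "Neg A \<in> stage \<gamma> \<Longrightarrow> A \<notin> J" and "Pos A \<in> stage \<gamma> \<Longrightarrow> A \<in> J"
    by blast+
qed

lemma GL_op_agrees: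
  assumes J: "\<forall>A \<in> B. level B G I A < \<gamma> \<longrightarrow> (A \<in> J \<longleftrightarrow> A \<in> I)"
    and A: "A \<in> B" "level B G I A \<le> \<gamma>"
  shows "A \<in> GL_op B G J \<longleftrightarrow> A \<in> I"
proof -
  \<comment> \<open>\<open>A\<close> is decided at the successor of its level, hence by one Fitting
    step from \<open>?S\<close>. This off-by-one is what gains a level: only agreement strictly
    below the level of \<open>A\<close> is needed.\<close>
  let ?S = "stage (level B G I A)"
  have below: "\<forall>A' \<in> B. level B G I A' < level B G I A \<longrightarrow> (A' \<in> J \<longleftrightarrow> A' \<in> I)"
    using J A(2) by auto
  note agrees = stage_agrees[OF below]
  show ?thesis
  proof (cases "A \<in> I")
    case True
    with level_decided[OF A(1)] obtain b
      where b: "Clause A b \<in> fixpoint_completion G" "set b \<subseteq> ?S"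
      by (auto simp: transfinite_iter_osuc Pos_in_fitting_op)
    then have "\<forall>l \<in> set b. l \<notin> Neg ` J"
      using agrees(1) by blast
    with b(1) have "A \<in> GL_op B G J"
      by (simp only: GL_op_iff[of G B, OF G]) blast
    with True show ?thesis by simp
  next
    case False
    with level_decided[OF A(1)]
    have blocked: "\<forall>b. Clause A b \<in> fixpoint_completion G \<longrightarrow> (\<exists>l \<in> set b. compl_lit l \<in> ?S)"
      by (simp add: transfinite_iter_osuc Neg_in_fitting_op)
    have "\<exists>l \<in> set b. l \<in> Neg ` J" if b: "Clause A b \<in> fixpoint_completion G" for b
    proof -
      obtain l where l: "l \<in> set b" "compl_lit l \<in> ?S"
        using blocked b by blast
      \<comment> \<open>Completion bodies are purely negative, so the complement found in
        \<open>?S\<close> is a positive literal and puts \<open>A'\<close> into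
        \<open>J\<close>.\<close>
      moreover obtain A' where "l = Neg A'"
        using fixpoint_completion_body[OF b] l(1) by blast
      ultimately show ?thesis
        using agrees(2) by auto
    qed
    then have "A \<notin> GL_op B G J"
      by (simp only: GL_op_iff[of G B, OF G]) blast
    with False show ?thesis by simp
  qed
qed

lemma strictly_contracting_GL_op:
  assumes \<alpha>: "\<forall>A \<in> B. level B G I A < \<alpha>"
  shows "strictly_contracting (Pow B) (rho B (level B G I) \<alpha> I) (GL_op B G)"
proof -
  let ?d = "level_dist B (level B G I) \<alpha>"
  note le_iff = level_dist_le_iff[OF \<alpha> _ I] and zero = level_dist_le_zero_iff[OF \<alpha> _ I]
  \<comment> \<open>The bound is an arbitrary nonzero \<open>\<gamma>\<close> instead of the
    distance of \<open>J\<close> itself: one of the two arguments may equal \<open>I\<close>, and a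
    zero distance cannot decrease.\<close>
  have less: "?d (GL_op B G J) I < \<gamma>" if "J \<subseteq> B" "?d J I \<le> \<gamma>" "dual \<alpha> < \<gamma>" for J \<gamma>
  proof -
    obtain \<beta> where \<gamma>: "\<gamma> = dual \<beta>" by (metis dual_undual)
    with that(3) have \<beta>: "\<beta> < \<alpha>" by simp
    \<comment> \<open>The improved radius \<open>dual (osuc \<beta>)\<close> must remain in the
      range where distance bounds translate into agreement.\<close>
    then have "osuc \<beta> \<le> \<alpha>" by (metis less_osuc_iff not_le)
    moreover have "\<forall>A \<in> B. level B G I A < \<beta> \<longrightarrow> (A \<in> J \<longleftrightarrow> A \<in> I)"
      using le_iff[of J \<beta>] that \<gamma> \<beta> by simp
    then have "\<forall>A \<in> B. level B G I A < osuc \<beta> \<longrightarrow> (A \<in> GL_op B G J \<longleftrightarrow> A \<in> I)"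
      using GL_op_agrees by (simp add: less_osuc_iff)
    ultimately have "?d (GL_op B G J) I \<le> dual (osuc \<beta>)"
      using le_iff[OF GL_op_subset] by blast
    also have "dual (osuc \<beta>) < \<gamma>"
      by (simp add: \<gamma> less_osuc)
    finally show ?thesis .
  qed
  have "rho B (level B G I) \<alpha> I (GL_op B G J) (GL_op B G K) < rho B (level B G I) \<alpha> I J K"
    if "J \<subseteq> B" "K \<subseteq> B" "J \<noteq> K" for J K
  proof -
    let ?\<gamma> = "rho B (level B G I) \<alpha> I J K"
    have \<gamma>: "?d J I \<le> ?\<gamma>" "?d K I \<le> ?\<gamma>"
      using rho_le_iff by blast+
    \<comment> \<open>If \<open>rho\<close> were zero, both arguments would equal \<open>I\<close>,
      contrary to \<open>J \<noteq> K\<close>.\<close>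
    have "dual \<alpha> < ?\<gamma>"
    proof (rule ccontr)
      assume "\<not> ?thesis"
      then have "?d J I \<le> dual \<alpha>" "?d K I \<le> dual \<alpha>"
        using \<gamma> by auto
      with zero that show False by blast
    qed
    with less that(1,2) \<gamma> have "?d (GL_op B G J) I < ?\<gamma>" "?d (GL_op B G K) I < ?\<gamma>"
      by blast+
    then show ?thesis
      by (simp add: rho_def[of B _ \<alpha> I "GL_op B G J"] level_dist_commute[of B _ \<alpha> I])
  qed
  then show ?thesis
    using GL_op_subset[of B G] by (auto simp: strictly_contracting_def)
qed

end

theorem theorem7:
  fixes L :: "('f, 'p) language"
    and P :: "('p, 'f, 'v) atom clause set"
    and I :: "('p, 'f, 'v) atom set"
    and \<alpha> :: "('p, 'f, 'v) atom ordinal"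
  defines "B \<equiv> herbrand_base L"
    and "G \<equiv> grounding L P"
  defines "l \<equiv> level B G I"
  assumes "normal_program L P"
    and "I \<subseteq> B"
    and "well_founded_model B G = Pos ` I \<union> Neg ` (B - I)"
    and "\<forall>A \<in> B. l A < \<alpha>"
  shows "dislocated_gen_ultrametric (Pow B) (Gamma \<alpha>) (dual \<alpha>) (rho B l \<alpha> I) \<and>
         spherically_complete (Pow B) (Gamma \<alpha>) (rho B l \<alpha> I) \<and>
         strictly_contracting (Pow B) (rho B l \<alpha> I) (GL_op B G)"
proof -
  have G: "atoms C \<subseteq> B" if "C \<in> G" for C
    using grounding_subset_herbrand_base assms(4) that unfolding B_def G_def .
  show ?thesis
    using dislocated_gen_ultrametric_rho[OF assms(7,5)] spherically_complete_rho[OF assms(7,5)]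
      strictly_contracting_GL_op[OF G assms(5,6)] assms(7)
    unfolding l_def by blast
qed

end
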